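(* Let $s\in(0,1)$, let $\Omega\subseteq\mathbb{R}^n$ be an open bounded Lipschitz domain, let $\Lambda\ge 0$ and let $E\subseteq\mathbb{R}^n$. Then $E$ is $\Lambda$-minimal for the $s$-perimeter in $\Omega$ if and only if $E$ satisfies both the $\Lambda$-super-solution property and the $\Lambda$-sub-solution property in $\Omega$.
   Context: $n\ge1$ is an integer; all sets are Lebesgue measurable; $|\cdot|$ is Lebesgue measure, $A^c=\mathbb{R}^n\setminus A$, $A\Delta B$ is the symmetric difference. For disjoint sets $A,B\subseteq\mathbb{R}^n$, $\mathcal{L}(A,B):=\int_A\int_B\frac{dx\,dy}{|x-y|^{n+s}}$. The $s$-perimeter of $E$ in $\Omega$ is $\operatorname{Per}_s(E,\Omega):=\mathcal{L}(E\cap\Omega,E^c)+\mathcal{L}(E\cap\Omega^c,E^c\cap\Omega)$. $E$ is $\Lambda$-minimal for the $s$-perimeter in $\Omega$ if $\operatorname{Per}_s(E,\Omega)<+\infty$ and $\operatorname{Per}_s(E,\Omega)\le\operatorname{Per}_s(F,\Omega)+\Lambda|E\Delta F|$ for every set $F$ with $E\Delta F\subseteq\Omega$. $E$ satisfies the $\Lambda$-super-solution property (in $\Omega$) if for every $A\subseteq E^c\cap\Omega$ one has $\mathcal{L}(A,E)-\mathcal{L}(A,E^c\setminus A)\le\Lambda|A|$. $E$ satisfies the $\Lambda$-sub-solution property (in $\Omega$) if for every $A\subseteq E\cap\Omega$ one has $\mathcal{L}(A,E\setminus A)-\mathcal{L}(A,E^c)\ge-\Lambda|A|$. *)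

theory Defs
  imports "HOL-Analysis.Analysis"
begin

(* Only ever used for disjoint A and B, so the value 1 / 0 = 0 of the kernel on the diagonal
   is irrelevant. *)
definition interaction :: "real \<Rightarrow> (real ^ 'n) set \<Rightarrow> (real ^ 'n) set \<Rightarrow> ereal" where
  "interaction s A B =
     enn2ereal (\<integral>\<^sup>+x\<in>A. (\<integral>\<^sup>+y\<in>B. ennreal (1 / norm (x - y) powr (real CARD('n) + s)) \<partial>lebesgue) \<partial>lebesgue)"

definition s_perimeter :: "real \<Rightarrow> (real ^ 'n) set \<Rightarrow> (real ^ 'n) set \<Rightarrow> ereal" where
  "s_perimeter s E \<Omega> = interaction s (E \<inter> \<Omega>) (- E) + interaction s (E \<inter> - \<Omega>) (- E \<inter> \<Omega>)"

abbreviation vol :: "(real ^ 'n) set \<Rightarrow> ereal" where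
  "vol A \<equiv> enn2ereal (emeasure lebesgue A)"

definition Lambda_minimal ::
    "real \<Rightarrow> real \<Rightarrow> (real ^ 'n) set \<Rightarrow> (real ^ 'n) set \<Rightarrow> bool" where
  "Lambda_minimal s \<Lambda> \<Omega> E \<longleftrightarrow>
     s_perimeter s E \<Omega> < \<infinity> \<and>
     (\<forall>F \<in> sets lebesgue. sym_diff E F \<subseteq> \<Omega> \<longrightarrow>
        s_perimeter s E \<Omega> \<le> s_perimeter s F \<Omega> + ereal \<Lambda> * vol (sym_diff E F))"

(* The differences below are differences of extended reals, where the library sets
   \<infinity> - \<infinity> = \<infinity>.  This convention has no influence when \<Omega> is a bounded Lipschitz domain: there
   interaction s \<Omega> (- \<Omega>) is finite.  For the largest admissible set A = - E \<inter> \<Omega>, the subtrahend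
   interaction s A (- E - A) in super_solution is therefore finite, so the inequality makes
   interaction s A E finite, and by monotonicity it is then finite for every admissible A.
   Likewise, A = E \<inter> \<Omega> in sub_solution makes interaction s A (- E) finite for every admissible A. *)
definition super_solution ::
    "real \<Rightarrow> real \<Rightarrow> (real ^ 'n) set \<Rightarrow> (real ^ 'n) set \<Rightarrow> bool" where
  "super_solution s \<Lambda> \<Omega> E \<longleftrightarrow>
     (\<forall>A \<in> sets lebesgue. A \<subseteq> - E \<inter> \<Omega> \<longrightarrow>
        interaction s A E - interaction s A (- E - A) \<le> ereal \<Lambda> * vol A)"

definition sub_solution ::
    "real \<Rightarrow> real \<Rightarrow> (real ^ 'n) set \<Rightarrow> (real ^ 'n) set \<Rightarrow> bool" where
  "sub_solution s \<Lambda> \<Omega> E \<longleftrightarrow>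
     (\<forall>A \<in> sets lebesgue. A \<subseteq> E \<inter> \<Omega> \<longrightarrow>
        interaction s A (E - A) - interaction s A (- E) \<ge> - (ereal \<Lambda> * vol A))"

(* Near each boundary point, \<Omega> is the part of the space above the graph of a Lipschitz function
   g over the hyperplane orthogonal to a unit vector e; x - (x \<bullet> e) e is the orthogonal
   projection of x to that hyperplane.  Connectedness is not required. *)
definition lipschitz_domain :: "(real ^ 'n) set \<Rightarrow> bool" where
  "lipschitz_domain \<Omega> \<longleftrightarrow>
     open \<Omega> \<and>
     (\<forall>p \<in> frontier \<Omega>. \<exists>r > 0. \<exists>e. \<exists>g :: real ^ 'n \<Rightarrow> real. \<exists>L.
        norm e = 1 \<and> L-lipschitz_on {z. z \<bullet> e = 0} g \<and>
        \<Omega> \<inter> ball p r = {x \<in> ball p r. x \<bullet> e > g (x - (x \<bullet> e) *\<^sub>R e)})"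

end

theory Submission
  imports Defs
begin

text \<open>With \<open>A = F - E\<close> and \<open>B = E - F\<close>, both perimeters split into interactions of the six pieces cut out
  by \<open>A\<close>, \<open>B\<close>, \<open>E\<close> and \<open>\<Omega>\<close>; up to a common term \<open>X\<close>,
  \<open>Per(E) = X + L(A, E) + L(B, E\<^sup>c) - L(A, B)\<close> and
  \<open>Per(F) = X + L(A, E\<^sup>c - A) + L(B, E - B) + L(A, B)\<close>. The two one-sided inequalities are the cases
  \<open>B = {}\<close> and \<open>A = {}\<close>, and adding them gives minimality because \<open>L(A, B) \<ge> 0\<close>.

  That \<open>Per(E)\<close> is finite follows from \<open>L(\<Omega>, \<Omega>\<^sup>c) < \<infinity>\<close>. This interaction is the integral of
  \<open>|{x \<in> \<Omega>. x + h \<notin> \<Omega>}| / |h| powr (n + s)\<close> over \<open>h\<close>, and for a bounded Lipschitz domain the numerator is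
  \<open>O(min(|h|, 1))\<close>, so summing over dyadic shells converges for \<open>0 < s < 1\<close>.\<close>

section \<open>Interaction energies of a general kernel\<close>

text \<open>The kernel is left abstract and values stay in \<open>ennreal\<close>: additivity needs
  only measurability, and symmetry also evenness, so no integrability has to be checked.\<close>

definition energy :: "('a::euclidean_space \<Rightarrow> ennreal) \<Rightarrow> 'a set \<Rightarrow> 'a set \<Rightarrow> ennreal" where
  "energy k A B = (\<integral>\<^sup>+x\<in>A. (\<integral>\<^sup>+y\<in>B. k (x - y) \<partial>lebesgue) \<partial>lebesgue)"

lemma AE_main_part_iff:
  assumes "A \<in> sets lebesgue"
  shows "AE x in lborel. x \<in> A \<longleftrightarrow> x \<in> main_part lborel A"
  using AE_notin_null_part[OF assms] main_part_null_part_Un[OF assms]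
  unfolding AE_completion_iff by (auto elim!: eventually_mono)

text \<open>Tonelli is applied over \<open>lborel\<close>, while the sets are only Lebesgue
  measurable. A Lebesgue set agrees with its Borel main part up to a null set, and completing the
  measure does not change the integral, so computations move to Borel sets.\<close>

lemma nn_set_integral_main_part:
  assumes "A \<in> sets lebesgue"
  shows "(\<integral>\<^sup>+x\<in>A. f x \<partial>lebesgue) = (\<integral>\<^sup>+x\<in>main_part lborel A. f x \<partial>lborel)"
  unfolding nn_integral_completion
  by (rule nn_integral_cong_AE, use AE_main_part_iff[OF assms] in eventually_elim)
     (simp add: indicator_def)

lemma sets_main_part_lborel [measurable]:
  "A \<in> sets lebesgue \<Longrightarrow> main_part lborel A \<in> sets borel"
  using main_part_sets[of A lborel] by simp

lemma borel_measurable_potential: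
  assumes [measurable]: "k \<in> borel_measurable borel" and B: "B \<in> sets lebesgue"
  shows "(\<lambda>x. \<integral>\<^sup>+y\<in>B. k (x - y) \<partial>lebesgue) \<in> borel_measurable lebesgue"
proof -
  note [measurable] = sets_main_part_lborel[OF B]
  have "(\<lambda>x. \<integral>\<^sup>+y\<in>main_part lborel B. k (x - y) \<partial>lborel) \<in> borel_measurable lborel"
    by measurable
  then show ?thesis
    unfolding nn_set_integral_main_part[OF B] by (rule measurable_completion)
qed

lemma energy_Un_left:
  assumes "k \<in> borel_measurable borel"
    and "A \<in> sets lebesgue" "B \<in> sets lebesgue" "C \<in> sets lebesgue" "A \<inter> B = {}"
  shows "energy k (A \<union> B) C = energy k A C + energy k B C"
  unfolding energy_def
  by (rule nn_integral_disjoint_pair) (use assms borel_measurable_potential in auto)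

text \<open>Tonelli on the Borel main parts exchanges the integrals; evenness exchanges the two
  points in the kernel.\<close>

lemma energy_commute:
  fixes A B :: "'a::euclidean_space set"
  assumes k [measurable]: "k \<in> borel_measurable borel" and even: "\<And>z. k (- z) = k z"
    and A: "A \<in> sets lebesgue" and B: "B \<in> sets lebesgue"
  shows "energy k A B = energy k B A"
proof -
  note [measurable] = sets_main_part_lborel[OF A] sets_main_part_lborel[OF B]
  let ?A = "main_part lborel A" and ?B = "main_part lborel B"
  have sym: "k (x - y) = k (y - x)" for x y
    using even[of "x - y"] by simp
  have "energy k A B = (\<integral>\<^sup>+x. \<integral>\<^sup>+y. k (x - y) * indicator ?B y * indicator ?A x \<partial>lborel \<partial>lborel)"
    unfolding energy_def nn_set_integral_main_part[OF A] nn_set_integral_main_part[OF B]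
    by (intro nn_integral_cong nn_integral_multc[symmetric]) measurable
  also have "\<dots> = (\<integral>\<^sup>+y. \<integral>\<^sup>+x. k (x - y) * indicator ?B y * indicator ?A x \<partial>lborel \<partial>lborel)"
    by (rule lborel_pair.Fubini'[symmetric]) measurable
  also have "\<dots> = (\<integral>\<^sup>+y. \<integral>\<^sup>+x. k (y - x) * indicator ?A x * indicator ?B y \<partial>lborel \<partial>lborel)"
    by (intro nn_integral_cong) (simp add: sym mult_ac)
  also have "\<dots> = energy k B A"
    unfolding energy_def nn_set_integral_main_part[OF A] nn_set_integral_main_part[OF B]
    by (intro nn_integral_cong nn_integral_multc) measurable
  finally show ?thesis .
qed

lemma energy_Un_right:
  assumes "k \<in> borel_measurable borel"
    and "A \<in> sets lebesgue" "B \<in> sets lebesgue" "C \<in> sets lebesgue" "B \<inter> C = {}"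
  shows "energy k A (B \<union> C) = energy k A B + energy k A C"
proof -
  note [measurable] = assms(1)
  have k: "(\<lambda>y. k (x - y)) \<in> borel_measurable lebesgue" for x
    by (intro measurable_completion) measurable
  have "energy k A (B \<union> C)
    = (\<integral>\<^sup>+x\<in>A. ((\<integral>\<^sup>+y\<in>B. k (x - y) \<partial>lebesgue) + (\<integral>\<^sup>+y\<in>C. k (x - y) \<partial>lebesgue)) \<partial>lebesgue)"
    unfolding energy_def
    by (intro nn_integral_cong arg_cong2[where f = "(*)"] nn_integral_disjoint_pair)
       (use assms k in auto)
  also have "\<dots> = energy k A B + energy k A C"
    unfolding energy_def distrib_right
    by (intro nn_integral_add borel_measurable_times_ennreal borel_measurable_indicator
              borel_measurable_potential assms)
  finally show ?thesis .
qed

lemma energy_mono: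
  assumes "A \<subseteq> A'" "B \<subseteq> B'"
  shows "energy k A B \<le> energy k A' B'"
  unfolding energy_def
  by (intro nn_integral_mono mult_mono) (use assms in \<open>auto simp: indicator_def\<close>)

text \<open>The substitution \<open>y = x + h\<close> turns \<open>k (x - y)\<close> into
  \<open>k (- h) = k h\<close>, which is free of \<open>x\<close>. After Tonelli the
  \<open>x\<close>-integral only measures the points that the shift by \<open>h\<close> moves out of
  \<open>U\<close>.\<close>

lemma energy_Compl_eq_translates:
  fixes U :: "'a::euclidean_space set"
  assumes k [measurable]: "k \<in> borel_measurable borel" and even: "\<And>z. k (- z) = k z"
    and U [measurable]: "U \<in> sets borel"
  shows "energy k U (- U) = (\<integral>\<^sup>+h. k h * emeasure lborel {x \<in> U. x + h \<notin> U} \<partial>lborel)"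
proof -
  have "(\<integral>\<^sup>+y\<in>- U. k (x - y) \<partial>lborel) = (\<integral>\<^sup>+h. k h * indicator (- U) (x + h) \<partial>lborel)" for x
  proof -
    have "(\<integral>\<^sup>+y\<in>- U. k (x - y) \<partial>lborel) = (\<integral>\<^sup>+y\<in>- U. k (x - y) \<partial>distr lborel borel ((+) x))"
      by (simp add: lborel_distr_plus)
    also have "\<dots> = (\<integral>\<^sup>+h. k h * indicator (- U) (x + h) \<partial>lborel)"
      by (subst nn_integral_distr) (auto simp: even)
    finally show ?thesis .
  qed
  then have "energy k U (- U)
      = (\<integral>\<^sup>+x. (\<integral>\<^sup>+h. k h * indicator (- U) (x + h) \<partial>lborel) * indicator U x \<partial>lborel)"
    unfolding energy_def nn_integral_completion by simp
  also have "\<dots> = (\<integral>\<^sup>+x. \<integral>\<^sup>+h. k h * indicator (- U) (x + h) * indicator U x \<partial>lborel \<partial>lborel)"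
    by (intro nn_integral_cong nn_integral_multc[symmetric]) measurable
  also have "\<dots> = (\<integral>\<^sup>+h. \<integral>\<^sup>+x. k h * indicator (- U) (x + h) * indicator U x \<partial>lborel \<partial>lborel)"
    by (rule lborel_pair.Fubini'[symmetric]) measurable
  also have "\<dots> = (\<integral>\<^sup>+h. \<integral>\<^sup>+x. k h * indicator {x \<in> U. x + h \<notin> U} x \<partial>lborel \<partial>lborel)"
    by (intro nn_integral_cong) (auto simp: indicator_def)
  also have "\<dots> = (\<integral>\<^sup>+h. k h * emeasure lborel {x \<in> U. x + h \<notin> U} \<partial>lborel)"
    by (intro nn_integral_cong nn_integral_cmult_indicator) measurable
  finally show ?thesis .
qed

section \<open>Measure of thin slabs\<close>

lemma emeasure_lborel_vimage_plus:
  fixes T :: "'a::euclidean_space set"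
  assumes "T \<in> sets borel"
  shows "emeasure lborel ((+) c -` T) = emeasure lborel T"
  using assms emeasure_distr[of "(+) c" lborel borel T] by (simp add: lborel_distr_plus)

text \<open>The translates of the slab by multiples of its thickness \<open>\<tau>\<close> are disjoint, and about
  \<open>1 / \<tau>\<close> of them fit into a bounded ball.\<close>

lemma emeasure_slab_le:
  fixes T :: "'a::euclidean_space set" and \<phi> :: "'a \<Rightarrow> real"
  assumes T [measurable]: "T \<in> sets borel" and sub: "T \<subseteq> ball p r"
    and e: "norm e = 1" and \<phi>: "\<And>x c. \<phi> (x + c *\<^sub>R e) = \<phi> x + c"
    and slab: "\<And>x. x \<in> T \<Longrightarrow> 0 < \<phi> x \<and> \<phi> x \<le> \<tau>" and \<tau>: "0 < \<tau>" "\<tau> \<le> 1"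
  shows "emeasure lborel T \<le> ennreal (2 * \<tau> * measure lborel (ball p (r + 1)))"
proof -
  \<comment> \<open>\<open>N\<close> is the number of translates: \<open>N * \<tau> \<le> 1\<close>
    keeps them in the ball enlarged by 1, while adding \<open>N \<ge> 1\<close> and
    \<open>N > 1 / \<tau> - 1\<close> gives \<open>N \<ge> 1 / (2 * \<tau>)\<close>, the source of
    the factor 2 in the bound.\<close>
  define N where "N = nat \<lfloor>1 / \<tau>\<rfloor>"
  have "1 / \<tau> \<ge> 1" using \<tau> by simp
  then have fl: "\<lfloor>1 / \<tau>\<rfloor> \<ge> 1" by (simp only: one_le_floor)
  have N: "real N = of_int \<lfloor>1 / \<tau>\<rfloor>" unfolding N_def by (rule of_nat_nat) (use fl in linarith)
  have "real N \<ge> 1" using fl N by simp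
  moreover have "real N > 1 / \<tau> - 1" unfolding N by linarith
  ultimately have N_ge: "real N \<ge> 1 / (2 * \<tau>)" by (simp add: field_simps)
  have "real N \<le> 1 / \<tau>" unfolding N by linarith
  then have N_le: "real N * \<tau> \<le> 1" using \<tau> by (simp add: field_simps)
  \<comment> \<open>\<open>S j\<close> is \<open>T\<close> shifted by \<open>j * \<tau>\<close>
    along \<open>e\<close>. On it \<open>\<phi>\<close> exceeds \<open>j * \<tau>\<close> and is at
    most \<open>(j + 1) * \<tau>\<close>; these half-open ranges are disjoint.\<close>
  define S where "S j = (+) (- (real j * \<tau>) *\<^sub>R e) -` T" for j :: nat
  have S [measurable]: "S j \<in> sets borel" for j
    unfolding S_def by (rule measurable_sets_borel[OF _ T]) measurable
  have \<phi>S: "real j * \<tau> < \<phi> x \<and> \<phi> x \<le> real (Suc j) * \<tau>" if "x \<in> S j" for j x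
  proof -
    have "x + (- (real j * \<tau>)) *\<^sub>R e \<in> T"
      using that by (simp add: S_def algebra_simps)
    from slab[OF this] show ?thesis
      unfolding \<phi> by (simp add: algebra_simps)
  qed
  have "disjoint_family_on S {..<N}"
  proof (unfold disjoint_family_on_def, intro ballI impI)
    fix i j :: nat assume "i \<noteq> j"
    show "S i \<inter> S j = {}"
    proof (rule ccontr)
      assume "S i \<inter> S j \<noteq> {}"
      then obtain x where "x \<in> S i" "x \<in> S j" by blast
      then have "real i * \<tau> < real (Suc j) * \<tau>" "real j * \<tau> < real (Suc i) * \<tau>"
        using \<phi>S by (meson less_le_trans)+
      then have "i < Suc j" "j < Suc i" using \<tau> by (simp_all only: mult_less_cancel_right_pos of_nat_less_iff)
      then show False using \<open>i \<noteq> j\<close> by simp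
    qed
  qed
  then have "(\<Sum>j<N. emeasure lborel (S j)) = emeasure lborel (\<Union>j<N. S j)"
    by (intro sum_emeasure) auto
  also have "\<dots> \<le> emeasure lborel (ball p (r + 1))"
  proof (rule emeasure_mono)
    show "(\<Union>j<N. S j) \<subseteq> ball p (r + 1)"
    proof
      fix x assume "x \<in> (\<Union>j<N. S j)"
      then obtain j where j: "j < N" and "x \<in> S j" by blast
      then have "- (real j * \<tau>) *\<^sub>R e + x \<in> ball p r"
        using sub by (auto simp: S_def)
      then have 1: "norm (p - (x - (real j * \<tau>) *\<^sub>R e)) < r"
        by (simp add: dist_norm)
      have "real j * \<tau> \<le> real N * \<tau>" using j \<tau> by simp
      then have 2: "norm ((real j * \<tau>) *\<^sub>R e) \<le> 1" using order_trans[OF _ N_le] \<tau> e by simp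
      have "norm (p - x) \<le> norm (p - (x - (real j * \<tau>) *\<^sub>R e)) + norm ((real j * \<tau>) *\<^sub>R e)"
        using norm_triangle_ineq4[of "p - (x - (real j * \<tau>) *\<^sub>R e)" "(real j * \<tau>) *\<^sub>R e"]
        by (simp add: algebra_simps)
      then show "x \<in> ball p (r + 1)" using 1 2 by (simp add: dist_norm)
    qed
  qed simp
  also have "\<dots> = ennreal (measure lborel (ball p (r + 1)))"
    using emeasure_lborel_ball_finite[of p "r + 1"] by (intro emeasure_eq_ennreal_measure) auto
  also have "(\<Sum>j<N. emeasure lborel (S j)) = ennreal (real N) * emeasure lborel T"
    unfolding S_def by (simp add: emeasure_lborel_vimage_plus ennreal_of_nat_eq_real_of_nat)
  finally have *: "ennreal (real N) * emeasure lborel T \<le> ennreal (measure lborel (ball p (r + 1)))" .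
  \<comment> \<open>Multiplying by \<open>2 * \<tau> * N \<ge> 1\<close> takes the place of dividing
    by \<open>N\<close> in \<open>ennreal\<close>.\<close>
  have "emeasure lborel T \<le> ennreal (2 * \<tau>) * (ennreal (real N) * emeasure lborel T)"
  proof -
    have "1 \<le> 2 * \<tau> * real N" using N_ge \<tau> by (simp add: field_simps)
    then have "1 \<le> ennreal (2 * \<tau>) * ennreal (real N)"
      using \<tau> by (simp flip: ennreal_mult)
    then have "1 * emeasure lborel T \<le> ennreal (2 * \<tau>) * ennreal (real N) * emeasure lborel T"
      by (rule mult_right_mono) simp
    then show ?thesis by (simp add: mult.assoc)
  qed
  also have "\<dots> \<le> ennreal (2 * \<tau>) * ennreal (measure lborel (ball p (r + 1)))"
    by (intro mult_left_mono *) simp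
  also have "\<dots> = ennreal (2 * \<tau> * measure lborel (ball p (r + 1)))"
    using \<tau> by (simp flip: ennreal_mult)
  finally show ?thesis .
qed

section \<open>Integrability by dyadic shells\<close>

text \<open>One index per point suffices to bound \<open>g\<close> by the sum of \<open>c j\<close>
  times the indicator of the ball of radius \<open>r j\<close>, since all terms are nonnegative. For
  dyadic radii, whole balls in place of shells cost only a constant factor.\<close>

lemma nn_integral_finite_shells:
  fixes g :: "'a::euclidean_space \<Rightarrow> ennreal" and r c :: "nat \<Rightarrow> real"
  assumes r: "\<And>j. 0 < r j" and c: "\<And>j. 0 \<le> c j"
    and shell: "\<And>h. g h \<noteq> 0 \<Longrightarrow> \<exists>j. norm h < r j \<and> g h \<le> ennreal (c j)"
    and summable: "summable (\<lambda>j. c j * r j ^ DIM('a))"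
  shows "(\<integral>\<^sup>+h. g h \<partial>lborel) < \<infinity>"
proof -
  let ?m = "measure lborel (ball (0::'a) 1)"
  have ball: "emeasure lborel (ball (0::'a) (r j)) = ennreal (r j ^ DIM('a) * ?m)" for j
    using emeasure_lborel_ball_finite[of "0::'a" "r j"] content_ball_conv_unit_ball[of "r j" "0::'a"] r[of j]
    by (subst emeasure_eq_ennreal_measure) auto
  have "(\<integral>\<^sup>+h. g h \<partial>lborel) \<le> (\<integral>\<^sup>+h. (\<Sum>j. ennreal (c j) * indicator (ball 0 (r j)) h) \<partial>(lborel :: 'a measure))"
  proof (intro nn_integral_mono)
    fix h :: 'a
    show "g h \<le> (\<Sum>j. ennreal (c j) * indicator (ball 0 (r j)) h)"
    proof (cases "g h = 0")
      case False
      then obtain j where "norm h < r j" "g h \<le> ennreal (c j)" using shell by blast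
      then have "g h \<le> (\<Sum>i\<in>{j}. ennreal (c i) * indicator (ball 0 (r i)) h)"
        by simp
      also have "\<dots> \<le> (\<Sum>j. ennreal (c j) * indicator (ball 0 (r j)) h)"
        by (rule sum_le_suminf) auto
      finally show ?thesis .
    qed simp
  qed
  also have "\<dots> = (\<Sum>j. \<integral>\<^sup>+h. ennreal (c j) * indicator (ball 0 (r j)) h \<partial>(lborel :: 'a measure))"
    by (intro nn_integral_suminf borel_measurable_times_ennreal borel_measurable_indicator) auto
  also have "\<dots> = (\<Sum>j. ennreal (c j * r j ^ DIM('a) * ?m))"
  proof (rule arg_cong[where f = suminf], rule ext)
    fix j
    have "(\<integral>\<^sup>+h. ennreal (c j) * indicator (ball 0 (r j)) h \<partial>(lborel :: 'a measure))
        = ennreal (c j) * ennreal (r j ^ DIM('a) * ?m)"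
      by (subst nn_integral_cmult_indicator) (simp_all only: ball, simp)
    also have "\<dots> = ennreal (c j * (r j ^ DIM('a) * ?m))"
      using c[of j] by (rule ennreal_mult'[symmetric])
    finally show "(\<integral>\<^sup>+h. ennreal (c j) * indicator (ball 0 (r j)) h \<partial>(lborel :: 'a measure))
        = ennreal (c j * r j ^ DIM('a) * ?m)"
      by (simp only: mult.assoc)
  qed
  also have "\<dots> = ennreal (\<Sum>j. c j * r j ^ DIM('a) * ?m)"
    by (rule suminf_ennreal2[OF _ summable_mult2[OF summable]])
       (intro mult_nonneg_nonneg c zero_le_power less_imp_le[OF r] measure_nonneg)
  also have "\<dots> < \<infinity>" by simp
  finally show ?thesis .
qed

text \<open>Inside the unit ball the bound \<open>C * norm h\<close> leaves the order
  \<open>1 - n - s\<close>, integrable at the origin because \<open>s < 1\<close>; outside it the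
  bound \<open>M\<close> leaves the order \<open>- n - s\<close>, integrable at infinity because
  \<open>s > 0\<close>.\<close>

lemma nn_integral_fractional_kernel_finite:
  assumes s: "0 < s" "s < 1" and C: "0 \<le> C" and M: "0 \<le> M"
  shows "(\<integral>\<^sup>+h. ennreal (1 / norm h powr (real DIM('a) + s) * min (C * norm h) M)
           \<partial>(lborel :: 'a::euclidean_space measure)) < \<infinity>"
proof -
  let ?n = "real DIM('a)"
  define g where "g h = ennreal (1 / norm h powr (?n + s) * min (C * norm h) M)" for h :: 'a
  define g1 where "g1 h = (if norm h < 1 then g h else 0)" for h
  define g2 where "g2 h = (if norm h < 1 then 0 else g h)" for h
  have g_le: "g h \<le> ennreal (1 / norm h powr (?n + s) * b)" if "min (C * norm h) M \<le> b" for h b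
    unfolding g_def by (intro ennreal_leI mult_left_mono that) simp
  have "(\<integral>\<^sup>+h. g1 h \<partial>lborel) < \<infinity>"
  proof (rule nn_integral_finite_shells)
    let ?r = "\<lambda>j. 2 powr (- real j)"
    \<comment> \<open>On the shell from \<open>2 powr (- (j + 1))\<close> to
      \<open>2 powr (- j)\<close> the kernel is bounded by its value at the inner radius, and
      \<open>C * norm h\<close> by its value at the outer one.\<close>
    let ?c = "\<lambda>j. 2 powr ((real j + 1) * (?n + s)) * (C * 2 powr (- real j))"
    show "0 < ?r j" "0 \<le> ?c j" for j using C by auto
    have eq: "?c j * ?r j ^ DIM('a) = C * 2 powr (?n + s) * (2 powr (s - 1)) ^ j" for j
      by (simp add: powr_realpow[symmetric] powr_powr powr_add[symmetric] algebra_simps)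
    have "2 powr (s - 1) < 2 powr (0::real)" using s by (intro powr_less_mono) auto
    then show "summable (\<lambda>j. ?c j * ?r j ^ DIM('a))"
      unfolding eq by (auto intro!: summable_mult summable_geometric)
    fix h :: 'a assume "g1 h \<noteq> 0"
    then have h: "norm h < 1" "g h \<noteq> 0" by (auto simp: g1_def split: if_splits)
    \<comment> \<open>\<open>g\<close> vanishes at the origin, so the logarithm below is taken of a
      positive number.\<close>
    then have "h \<noteq> 0" by (auto simp: g_def)
    then have pos: "0 < norm h" by simp
    let ?t = "- log 2 (norm h)"
    have t: "0 < ?t" using h pos by (simp add: log_less_zero_cancel_iff)
    \<comment> \<open>Ceiling minus one, not floor: \<open>j < ?t\<close> must be strict because the
      balls are open.\<close>
    define j where "j = nat (\<lceil>?t\<rceil> - 1)"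
    have "0 < \<lceil>?t\<rceil>" using t by (simp only: zero_less_ceiling)
    then have "real j = of_int \<lceil>?t\<rceil> - 1" unfolding j_def by simp
    then have j: "real j < ?t" "?t \<le> real j + 1" by linarith+
    have n: "norm h = 2 powr (- ?t)" using pos by simp
    have lt: "norm h < 2 powr (- real j)" using j by (subst n) simp
    have ge: "2 powr (- (real j + 1)) \<le> norm h" using j by (subst n) simp
    have "1 / norm h powr (?n + s) \<le> 1 / (2 powr (- (real j + 1))) powr (?n + s)"
      using s ge pos by (intro divide_left_mono powr_mono2 mult_pos_pos) auto
    also have "\<dots> = 2 powr ((real j + 1) * (?n + s))"
      by (simp add: powr_powr powr_minus_divide[symmetric] algebra_simps)
    finally have "1 / norm h powr (?n + s) * (C * norm h) \<le> ?c j"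
      using lt C by (intro mult_mono) auto
    with g_le[of h "C * norm h"] have "g h \<le> ennreal (?c j)"
      by (meson ennreal_leI order_trans min.cobounded1)
    then show "\<exists>j. norm h < ?r j \<and> g1 h \<le> ennreal (?c j)"
      using lt h by (auto simp: g1_def)
  qed
  moreover have "(\<integral>\<^sup>+h. g2 h \<partial>lborel) < \<infinity>"
  proof (rule nn_integral_finite_shells)
    let ?r = "\<lambda>j. 2 powr (real j + 1)"
    \<comment> \<open>Here the shells run from \<open>2 powr j\<close> to
      \<open>2 powr (j + 1)\<close>, with the outer end excluded, so the floor of the logarithm is
      the right index.\<close>
    let ?c = "\<lambda>j. 2 powr (- real j * (?n + s)) * M"
    show "0 < ?r j" "0 \<le> ?c j" for j using M by auto
    have eq: "?c j * ?r j ^ DIM('a) = M * 2 powr ?n * (2 powr (- s)) ^ j" for j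
      by (simp add: powr_realpow[symmetric] powr_powr powr_add[symmetric] algebra_simps)
    have "2 powr (- s) < 2 powr (0::real)" using s by (intro powr_less_mono) auto
    then show "summable (\<lambda>j. ?c j * ?r j ^ DIM('a))"
      unfolding eq by (auto intro!: summable_mult summable_geometric)
    fix h :: 'a assume "g2 h \<noteq> 0"
    then have h: "norm h \<ge> 1" by (auto simp: g2_def split: if_splits)
    let ?t = "log 2 (norm h)"
    have pos: "0 < norm h" using h by linarith
    have t: "0 \<le> ?t" using h pos by (simp only: zero_le_log_cancel_iff)
    define j where "j = nat \<lfloor>?t\<rfloor>"
    have "real j = of_int \<lfloor>?t\<rfloor>" unfolding j_def using t by simp
    then have j: "real j \<le> ?t" "?t < real j + 1" by linarith+
    have n: "norm h = 2 powr ?t" using h by (subst powr_log_cancel) auto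
    have lt: "norm h < 2 powr (real j + 1)" using j(2) by (subst n) simp
    have ge: "2 powr (real j) \<le> norm h" using j(1) by (subst n) simp
    have "1 / norm h powr (?n + s) \<le> 1 / (2 powr (real j)) powr (?n + s)"
      using s ge h by (intro divide_left_mono powr_mono2 mult_pos_pos) auto
    also have "\<dots> = 2 powr (- real j * (?n + s))"
      by (simp add: powr_powr powr_minus_divide[symmetric] algebra_simps)
    finally have "1 / norm h powr (?n + s) * M \<le> ?c j"
      using M by (intro mult_right_mono) auto
    with g_le[of h M] have "g h \<le> ennreal (?c j)"
      by (meson ennreal_leI order_trans min.cobounded2)
    then show "\<exists>j. norm h < ?r j \<and> g2 h \<le> ennreal (?c j)"
      using lt h by (auto simp: g2_def)
  qed
  moreover have "(\<integral>\<^sup>+h. g h \<partial>lborel) = (\<integral>\<^sup>+h. g1 h + g2 h \<partial>lborel)"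
    by (intro nn_integral_cong) (simp add: g1_def g2_def)
  moreover have "\<dots> = (\<integral>\<^sup>+h. g1 h \<partial>lborel) + (\<integral>\<^sup>+h. g2 h \<partial>lborel)"
    unfolding g1_def g2_def g_def by (rule nn_integral_add) measurable
  ultimately show ?thesis
    unfolding g_def by simp
qed

section \<open>The fractional kernel and differences of extended reals\<close>

definition fractional_kernel :: "real \<Rightarrow> 'a::euclidean_space \<Rightarrow> ennreal" where
  "fractional_kernel s z = ennreal (1 / norm z powr (real DIM('a) + s))"

lemma fractional_kernel_measurable [measurable]: "fractional_kernel s \<in> borel_measurable borel"
  unfolding fractional_kernel_def[abs_def] by measurable

lemma fractional_kernel_minus: "fractional_kernel s (- z) = fractional_kernel s z"
  by (simp add: fractional_kernel_def)

lemma interaction_eq_energy: "interaction s A B = enn2ereal (energy (fractional_kernel s) A B)"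
  by (simp add: interaction_def energy_def fractional_kernel_def)

definition energy_perimeter :: "('a::euclidean_space \<Rightarrow> ennreal) \<Rightarrow> 'a set \<Rightarrow> 'a set \<Rightarrow> ennreal" where
  "energy_perimeter k E U = energy k (E \<inter> U) (- E) + energy k (E \<inter> - U) (- E \<inter> U)"

lemma s_perimeter_eq: "s_perimeter s E U = enn2ereal (energy_perimeter (fractional_kernel s) E U)"
  by (simp add: s_perimeter_def energy_perimeter_def interaction_eq_energy plus_ennreal.rep_eq)

text \<open>Since \<open>\<infinity> - \<infinity> = \<infinity>\<close>, an upper bound by a finite
  \<open>z\<close> already forces \<open>x\<close> to be finite, whatever \<open>y\<close>
  is.\<close>

lemma enn2ereal_diff_leD:
  assumes "enn2ereal x - enn2ereal y \<le> enn2ereal z" "z < \<infinity>"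
  shows "x \<le> y + z"
  using assms
  by (cases x; cases y; cases z) (auto simp: enn2ereal_ennreal simp flip: ennreal_plus)

text \<open>Finiteness of \<open>x\<close> excludes \<open>x = y = \<infinity>\<close> with finite
  \<open>z\<close>, where the sum inequality holds but the difference is
  \<open>\<infinity>\<close>.\<close>

lemma enn2ereal_diff_leI:
  assumes "x \<le> y + z" "x < \<infinity>"
  shows "enn2ereal x - enn2ereal y \<le> enn2ereal z"
  using assms
  by (cases x; cases y; cases z) (auto simp: enn2ereal_ennreal simp flip: ennreal_plus)

lemma uminus_enn2ereal_le_diffD:
  assumes "- enn2ereal z \<le> enn2ereal x - enn2ereal y" "z < \<infinity>"
  shows "y \<le> x + z"
  using assms
  by (cases x; cases y; cases z) (auto simp: enn2ereal_ennreal simp flip: ennreal_plus)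

lemma uminus_enn2ereal_le_diffI:
  assumes "y \<le> x + z" "y < \<infinity>"
  shows "- enn2ereal z \<le> enn2ereal x - enn2ereal y"
  using assms
  by (cases x; cases y; cases z) (auto simp: enn2ereal_ennreal simp flip: ennreal_plus)

section \<open>Perimeter of a perturbed set\<close>

text \<open>The cross term \<open>energy k A B\<close> is added on the left of the first identity
  rather than subtracted on the right, so both identities also hold for infinite values.\<close>

lemma energy_perimeter_perturbation:
  fixes E U A B :: "'a::euclidean_space set"
  assumes k: "k \<in> borel_measurable borel" and even: "\<And>z. k (- z) = k z"
    and sets: "E \<in> sets lebesgue" "U \<in> sets lebesgue" "A \<in> sets lebesgue" "B \<in> sets lebesgue"
    and A: "A \<subseteq> - E \<inter> U" and B: "B \<subseteq> E \<inter> U"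
  obtains X where
    "energy_perimeter k E U + energy k A B = X + energy k A E + energy k B (- E)"
    "energy_perimeter k (E \<union> A - B) U
       = X + energy k A (- E - A) + energy k B (E - B) + energy k A B"
proof -
  \<comment> \<open>With \<open>A\<close> and \<open>B\<close> these are the six pieces:
    \<open>P\<close>, \<open>Q\<close> stay in the set and \<open>C\<close>, \<open>D\<close> stay
    in its complement, inside and outside \<open>U\<close> respectively.\<close>
  define P Q C D where "P = E \<inter> U - B" and "Q = E - U" and "C = - E \<inter> U - A" and "D = - E - U"
  have m: "P \<in> sets lebesgue" "Q \<in> sets lebesgue" "C \<in> sets lebesgue" "D \<in> sets lebesgue"
    using sets unfolding P_def Q_def C_def D_def by (auto simp: Compl_in_sets_lebesgue intro!: sets.Int sets.Diff)
  have disj: "P \<inter> B = {}" "P \<inter> Q = {}" "B \<inter> Q = {}" "A \<inter> C = {}" "A \<inter> D = {}" "C \<inter> D = {}"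
    "P \<inter> A = {}" "B \<inter> C = {}" "B \<inter> D = {}"
    using A B unfolding P_def Q_def C_def D_def by auto
  have E: "E \<inter> U = P \<union> B" "- E = A \<union> (C \<union> D)" "E \<inter> - U = Q" "- E \<inter> U = A \<union> C"
    "E = P \<union> (B \<union> Q)" "- E - A = C \<union> D" "E - B = P \<union> Q"
    using A B unfolding P_def Q_def C_def D_def by auto
  have F: "(E \<union> A - B) \<inter> U = P \<union> A" "- (E \<union> A - B) = B \<union> (C \<union> D)"
    "(E \<union> A - B) \<inter> - U = Q" "- (E \<union> A - B) \<inter> U = B \<union> C"
    using A B unfolding P_def Q_def C_def D_def by auto
  note un = energy_Un_left[OF k] energy_Un_right[OF k] Int_Un_distrib Int_Un_distrib2 sets.Un sets m disj
  note comm = energy_commute[OF k even]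
  let ?e = "energy k"
  show thesis
  proof (rule that)
    \<comment> \<open>\<open>?X\<close> collects the interactions between pieces that do not change
      sides; the pair \<open>Q\<close>, \<open>D\<close> is absent because both lie outside
      \<open>U\<close>.\<close>
    let ?X = "?e P C + ?e P D + ?e Q C"
    have "energy_perimeter k E U = ?e (P \<union> B) (A \<union> (C \<union> D)) + ?e Q (A \<union> C)"
      unfolding energy_perimeter_def E(1,3,4) by (subst E(2)) simp
    moreover have "?e A E = ?e A P + (?e A B + ?e A Q)"
      by (subst E(5)) (simp add: un)
    moreover have "?e B (- E) = ?e B A + (?e B C + ?e B D)"
      by (subst E(2)) (simp add: un)
    moreover have "?e B A = ?e A B" "?e A P = ?e P A" "?e A Q = ?e Q A"
      using comm sets m by auto
    ultimately show "energy_perimeter k E U + ?e A B = ?X + ?e A E + ?e B (- E)"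
      by (simp add: un)
    have "energy_perimeter k (E \<union> A - B) U = ?e (P \<union> A) (B \<union> (C \<union> D)) + ?e Q (B \<union> C)"
      unfolding energy_perimeter_def F(1,3,4) by (subst F(2)) simp
    moreover have "?e B P = ?e P B" "?e B Q = ?e Q B"
      using comm sets m by auto
    ultimately show "energy_perimeter k (E \<union> A - B) U
       = ?X + ?e A (- E - A) + ?e B (E - B) + ?e A B"
      unfolding E(6,7) by (simp add: un)
  qed
qed

section \<open>Translates of a bounded Lipschitz domain\<close>

text \<open>The height above the graph, \<open>x \<bullet> e - g (\<pi> x)\<close> with
  \<open>\<pi>\<close> the projection along \<open>e\<close>, changes by at most
  \<open>(L + 1) * norm h\<close> under a shift by \<open>h\<close>. Points leaving \<open>U\<close>
  therefore lie in a slab of that thickness.\<close>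

lemma lipschitz_graph_translates_le:
  fixes U :: "'a::euclidean_space set"
  assumes U: "open U" and r: "0 < r" and e: "norm e = 1"
    and g: "L-lipschitz_on {z. z \<bullet> e = 0} g"
    and graph: "U \<inter> ball p r = {x \<in> ball p r. x \<bullet> e > g (x - (x \<bullet> e) *\<^sub>R e)}"
  obtains \<rho> C where "0 < \<rho>" "0 \<le> C"
    "\<And>h. norm h < \<rho> \<Longrightarrow> emeasure lborel ({x \<in> U. x + h \<notin> U} \<inter> ball p \<rho>) \<le> ennreal (C * norm h)"
proof
  have L: "0 \<le> L" using g by (rule lipschitz_on_nonneg)
  \<comment> \<open>The bound \<open>r / 2\<close> keeps \<open>x + h\<close> in the chart ball;
    \<open>1 / (L + 1)\<close> makes the slab thickness at most 1.\<close>
  define \<rho> where "\<rho> = min (r / 2) (1 / (L + 1))"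
  define C where "C = 2 * (L + 1) * measure lborel (ball p (\<rho> + 1))"
  show "0 < \<rho>" using r L by (simp add: \<rho>_def)
  show "0 \<le> C" using L by (simp add: C_def)
  fix h :: 'a assume h: "norm h < \<rho>"
  have [measurable]: "U \<in> sets borel" using U by simp
  have ee: "e \<bullet> e = 1" using e by (simp add: dot_square_norm)
  define \<pi> where "\<pi> x = x - (x \<bullet> e) *\<^sub>R e" for x
  have \<pi>: "\<pi> x \<in> {z. z \<bullet> e = 0}" for x
    by (simp add: \<pi>_def inner_diff_left ee)
  show "emeasure lborel ({x \<in> U. x + h \<notin> U} \<inter> ball p \<rho>) \<le> ennreal (C * norm h)"
  \<comment> \<open>For \<open>h = 0\<close> the set is empty; the slab estimate requires positive
    thickness.\<close>
  proof (cases "h = 0")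
    case False
    have "emeasure lborel ({x \<in> U. x + h \<notin> U} \<inter> ball p \<rho>)
        \<le> ennreal (2 * ((L + 1) * norm h) * measure lborel (ball p (\<rho> + 1)))"
    proof (rule emeasure_slab_le[OF _ _ e])
      let ?\<phi> = "\<lambda>x. x \<bullet> e - g (\<pi> x)"
      show "?\<phi> (x + c *\<^sub>R e) = ?\<phi> x + c" for x c
        by (simp add: \<pi>_def inner_add_left ee algebra_simps)
      show "0 < (L + 1) * norm h" using L False by simp
      have "norm h \<le> 1 / (L + 1)" using h by (simp add: \<rho>_def)
      then show "(L + 1) * norm h \<le> 1" using L by (simp add: field_simps)
      fix x assume "x \<in> {x \<in> U. x + h \<notin> U} \<inter> ball p \<rho>"
      then have x: "x \<in> U" "x + h \<notin> U" "dist p x < \<rho>" by auto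
      have xr: "x \<in> ball p r" using x r by (simp add: \<rho>_def)
      have "dist p (x + h) \<le> dist p x + norm h"
        using norm_triangle_ineq4[of "p - x" h] by (simp add: dist_norm algebra_simps)
      then have xhr: "x + h \<in> ball p r" using x(3) h by (simp add: \<rho>_def)
      have 1: "g (\<pi> x) < x \<bullet> e" using graph x(1) xr unfolding \<pi>_def by blast
      have 2: "(x + h) \<bullet> e \<le> g (\<pi> (x + h))" using graph x(2) xhr unfolding \<pi>_def by fastforce
      have "\<pi> (x + h) - \<pi> x = \<pi> h" by (simp add: \<pi>_def inner_add_left algebra_simps)
      moreover have "norm (\<pi> h) \<le> norm h"
      proof (rule norm_le_square[THEN iffD2], intro conjI)
        show "\<pi> h \<bullet> \<pi> h \<le> (norm h)\<^sup>2"
          by (simp add: \<pi>_def inner_diff_left inner_diff_right ee inner_commute power2_norm_eq_inner)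
      qed simp
      ultimately have "\<bar>g (\<pi> (x + h)) - g (\<pi> x)\<bar> \<le> L * norm h"
        using lipschitz_onD[OF g \<pi> \<pi>, of "x + h" x] L
        by (simp add: dist_norm) (meson mult_left_mono order_trans)
      moreover have "\<bar>h \<bullet> e\<bar> \<le> norm h" using Cauchy_Schwarz_ineq2[of h e] e by simp
      ultimately show "0 < ?\<phi> x \<and> ?\<phi> x \<le> (L + 1) * norm h"
        using 1 2 by (auto simp: inner_add_left algebra_simps)
    qed auto
    then show ?thesis by (simp add: C_def mult_ac)
  qed simp
qed

text \<open>Compactness of the frontier reduces short shifts to finitely many charts; for long
  shifts the measure of \<open>U\<close> itself is at most a multiple of
  \<open>norm h\<close>.\<close>

lemma bounded_lipschitz_domain_translates_le:
  fixes U :: "(real ^ 'n) set"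
  assumes "lipschitz_domain U" and bnd: "bounded U"
  obtains C where "0 \<le> C"
    "\<And>h. emeasure lborel {x \<in> U. x + h \<notin> U} \<le> ennreal (C * norm h)"
proof -
  have U: "open U" using assms by (simp add: lipschitz_domain_def)
  then have [measurable]: "U \<in> sets borel" by simp
  let ?T = "\<lambda>h. {x \<in> U. x + h \<notin> U}"
  have T: "?T h \<in> sets borel" for h by measurable
  have "\<forall>p\<in>frontier U. \<exists>\<rho> C. 0 < \<rho> \<and> 0 \<le> C \<and>
    (\<forall>h. norm h < \<rho> \<longrightarrow> emeasure lborel (?T h \<inter> ball p \<rho>) \<le> ennreal (C * norm h))"
  proof
    fix p assume "p \<in> frontier U"
    then obtain r e g L where "0 < r" "norm e = 1" "L-lipschitz_on {z. z \<bullet> e = 0} g"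
      "U \<inter> ball p r = {x \<in> ball p r. x \<bullet> e > g (x - (x \<bullet> e) *\<^sub>R e)}"
      using assms(1) unfolding lipschitz_domain_def by blast
    then show "\<exists>\<rho> C. 0 < \<rho> \<and> 0 \<le> C \<and>
      (\<forall>h. norm h < \<rho> \<longrightarrow> emeasure lborel (?T h \<inter> ball p \<rho>) \<le> ennreal (C * norm h))"
      by (rule lipschitz_graph_translates_le[OF U]) blast
  qed
  then obtain \<rho> C where \<rho>: "\<And>p. p \<in> frontier U \<Longrightarrow> 0 < \<rho> p"
    and C: "\<And>p. p \<in> frontier U \<Longrightarrow> 0 \<le> C p"
    and loc: "\<And>p h. \<lbrakk>p \<in> frontier U; norm h < \<rho> p\<rbrakk>
       \<Longrightarrow> emeasure lborel (?T h \<inter> ball p (\<rho> p)) \<le> ennreal (C p * norm h)"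
    unfolding bchoice_iff by blast
  have "compact (frontier U)" using bnd by (rule compact_frontier_bounded)
  moreover have "frontier U \<subseteq> (\<Union>p\<in>frontier U. ball p (\<rho> p / 2))"
    using \<rho> by force
  ultimately obtain D where D: "D \<subseteq> frontier U" "finite D" "frontier U \<subseteq> (\<Union>p\<in>D. ball p (\<rho> p / 2))"
    by (elim compactE_image) auto
  \<comment> \<open>Half radii leave room to reach points within \<open>\<delta>\<close> of the
    frontier inside the full chart balls. The inserted 1 keeps the minimum defined when
    \<open>D\<close> is empty.\<close>
  define \<delta> where "\<delta> = Min (insert 1 ((\<lambda>p. \<rho> p / 2) ` D))"
  have \<delta>: "0 < \<delta>" using D \<rho> by (auto simp: \<delta>_def)
  have \<delta>_le: "\<delta> \<le> \<rho> p / 2" if "p \<in> D" for p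
    unfolding \<delta>_def by (rule Min_le) (use D that in auto)
  have fin: "emeasure lborel U < \<infinity>" using bnd by (rule emeasure_bounded_finite)
  then have mU: "emeasure lborel U = ennreal (measure lborel U)"
    by (intro emeasure_eq_ennreal_measure) auto
  let ?C = "sum C D + measure lborel U / \<delta>"
  have sumC: "0 \<le> sum C D" using C D by (intro sum_nonneg) auto
  show thesis
  proof
    show "0 \<le> ?C" using sumC \<delta> by simp
    fix h :: "real ^ 'n"
    show "emeasure lborel (?T h) \<le> ennreal (?C * norm h)"
    proof (cases "norm h < \<delta>")
      case True
      have "?T h \<subseteq> (\<Union>p\<in>D. ?T h \<inter> ball p (\<rho> p))"
      proof safe
        fix x assume x: "x \<in> U" "x + h \<notin> U"
        \<comment> \<open>The segment joins a point of \<open>U\<close> to a point outside, so it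
          crosses the frontier at distance at most \<open>norm h\<close> from
          \<open>x\<close>.\<close>
        have "closed_segment x (x + h) \<inter> frontier U \<noteq> {}"
          by (rule connected_Int_frontier) (use x in auto)
        then obtain q where q: "q \<in> closed_segment x (x + h)" "q \<in> frontier U" by blast
        then obtain p where p: "p \<in> D" "dist p q < \<rho> p / 2" using D(3) by (auto simp: subset_iff)
        have "dist q x \<le> norm h"
          using segment_bound1[OF q(1)] by (simp add: dist_norm norm_minus_commute)
        then have "dist p x < \<rho> p"
          using dist_triangle[of p x q] p \<delta>_le[OF p(1)] True by linarith
        then show "x \<in> (\<Union>p\<in>D. ?T h \<inter> ball p (\<rho> p))" using x p by auto
      qed
      then have "emeasure lborel (?T h) \<le> emeasure lborel (\<Union>p\<in>D. ?T h \<inter> ball p (\<rho> p))"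
        by (rule emeasure_mono) (unfold sets_lborel, intro sets.finite_UN sets.Int D(2) T, simp)
      also have "\<dots> \<le> (\<Sum>p\<in>D. emeasure lborel (?T h \<inter> ball p (\<rho> p)))"
        using D(2) T by (intro emeasure_subadditive_finite) auto
      also have "\<dots> \<le> (\<Sum>p\<in>D. ennreal (C p * norm h))"
      proof (rule sum_mono)
        fix p assume p: "p \<in> D"
        then show "emeasure lborel (?T h \<inter> ball p (\<rho> p)) \<le> ennreal (C p * norm h)"
          using D(1) \<delta>_le[OF p] True \<delta> by (intro loc) auto
      qed
      also have "\<dots> = ennreal (sum C D * norm h)"
        using C D by (subst sum_ennreal) (auto simp: sum_distrib_right)
      also have "\<dots> \<le> ennreal (?C * norm h)"
        using \<delta> by (intro ennreal_leI mult_right_mono) auto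
      finally show ?thesis .
    next
      case False
      have "emeasure lborel (?T h) \<le> emeasure lborel U"
        by (rule emeasure_mono) auto
      also have "\<dots> \<le> ennreal (?C * norm h)"
        unfolding mU
      proof (rule ennreal_leI)
        have "measure lborel U \<le> measure lborel U / \<delta> * norm h"
          using mult_right_mono[of \<delta> "norm h" "measure lborel U"] False \<delta> by (simp add: field_simps)
        also have "\<dots> \<le> ?C * norm h"
          using sumC by (intro mult_right_mono) auto
        finally show "measure lborel U \<le> ?C * norm h" .
      qed
      finally show ?thesis .
    qed
  qed
qed

section \<open>Finite interaction of the domain with its complement\<close>

lemma fractional_energy_Compl_finite:
  fixes U :: "(real ^ 'n) set"
  assumes s: "0 < s" "s < 1" and lip: "lipschitz_domain U" and bnd: "bounded U"
  shows "energy (fractional_kernel s) U (- U) < \<infinity>"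
proof -
  have U: "U \<in> sets borel" using lip by (simp add: lipschitz_domain_def)
  obtain C where C: "0 \<le> C" "\<And>h. emeasure lborel {x \<in> U. x + h \<notin> U} \<le> ennreal (C * norm h)"
    using bounded_lipschitz_domain_translates_le[OF lip bnd] by blast
  let ?M = "measure lborel U"
  have M: "emeasure lborel {x \<in> U. x + h \<notin> U} \<le> ennreal ?M" for h
  proof -
    have "emeasure lborel {x \<in> U. x + h \<notin> U} \<le> emeasure lborel U"
      using U by (intro emeasure_mono) auto
    also have "\<dots> = ennreal ?M"
      using emeasure_bounded_finite[OF bnd] by (intro emeasure_eq_ennreal_measure) auto
    finally show ?thesis .
  qed
  have "energy (fractional_kernel s) U (- U)
      = (\<integral>\<^sup>+h. fractional_kernel s h * emeasure lborel {x \<in> U. x + h \<notin> U} \<partial>lborel)"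
    by (rule energy_Compl_eq_translates[OF fractional_kernel_measurable fractional_kernel_minus U])
  also have "\<dots> \<le> (\<integral>\<^sup>+h. ennreal (1 / norm h powr (real DIM(real ^ 'n) + s) * min (C * norm h) ?M)
      \<partial>(lborel :: (real ^ 'n) measure))"
  proof (intro nn_integral_mono)
    fix h :: "real ^ 'n"
    have "emeasure lborel {x \<in> U. x + h \<notin> U} \<le> ennreal (min (C * norm h) ?M)"
      using C(2)[of h] M[of h] by (simp add: min_def)
    then show "fractional_kernel s h * emeasure lborel {x \<in> U. x + h \<notin> U}
        \<le> ennreal (1 / norm h powr (real DIM(real ^ 'n) + s) * min (C * norm h) ?M)"
      unfolding fractional_kernel_def using C(1)
      by (subst ennreal_mult) (auto intro: mult_left_mono)
  qed
  also have "\<dots> < \<infinity>"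
    using s C(1) by (intro nn_integral_fractional_kernel_finite) auto
  finally show ?thesis .
qed

section \<open>Minimality versus the one-sided inequalities\<close>

lemma energy_empty [simp]: "energy k {} B = 0" "energy k A {} = 0"
  by (simp_all add: energy_def)

theorem lemma1p3:
  fixes s \<Lambda> :: real and \<Omega> E :: "(real ^ 'n) set"
  assumes "0 < s" and "s < 1"
    and "lipschitz_domain \<Omega>" and "bounded \<Omega>"
    and "\<Lambda> \<ge> 0"
    and "E \<in> sets lebesgue"
  shows "Lambda_minimal s \<Lambda> \<Omega> E \<longleftrightarrow> super_solution s \<Lambda> \<Omega> E \<and> sub_solution s \<Lambda> \<Omega> E"
proof -
  let ?e = "energy (fractional_kernel s :: real ^ 'n \<Rightarrow> ennreal)"
  let ?per = "\<lambda>E. energy_perimeter (fractional_kernel s) E \<Omega>"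
  let ?v = "\<lambda>A. ennreal \<Lambda> * emeasure lebesgue A"
  note perturb = energy_perimeter_perturbation[OF fractional_kernel_measurable fractional_kernel_minus]
  have \<Omega>: "\<Omega> \<in> sets lebesgue"
    using assms(3) by (simp add: lipschitz_domain_def)
  have v_finite: "?v A < \<infinity>" if "A \<subseteq> \<Omega>" for A
  proof -
    have "emeasure lebesgue A \<le> emeasure lebesgue \<Omega>"
      using that \<Omega> by (intro emeasure_mono)
    also have "\<dots> < \<infinity>" using emeasure_bounded_finite[OF assms(4)] \<Omega> assms(3)
      by (simp add: lipschitz_domain_def)
    finally show ?thesis by (simp add: ennreal_mult_less_top)
  qed
  have vol: "ereal \<Lambda> * vol A = enn2ereal (?v A)" for A :: "(real ^ 'n) set"
    using assms(5) by (simp add: times_ennreal.rep_eq enn2ereal_ennreal)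
  have minimal: "Lambda_minimal s \<Lambda> \<Omega> E \<longleftrightarrow> ?per E < \<infinity> \<and>
      (\<forall>F\<in>sets lebesgue. sym_diff E F \<subseteq> \<Omega> \<longrightarrow> ?per E \<le> ?per F + ?v (sym_diff E F))"
    unfolding Lambda_minimal_def s_perimeter_eq vol
    by (simp add: less_ennreal.rep_eq less_eq_ennreal.rep_eq plus_ennreal.rep_eq top_ennreal.rep_eq top_ereal_def)
  have super: "super_solution s \<Lambda> \<Omega> E \<longleftrightarrow> (\<forall>A\<in>sets lebesgue. A \<subseteq> - E \<inter> \<Omega> \<longrightarrow>
      enn2ereal (?e A E) - enn2ereal (?e A (- E - A)) \<le> enn2ereal (?v A))"
    unfolding super_solution_def interaction_eq_energy vol ..
  have sub: "sub_solution s \<Lambda> \<Omega> E \<longleftrightarrow> (\<forall>A\<in>sets lebesgue. A \<subseteq> E \<inter> \<Omega> \<longrightarrow>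
      - enn2ereal (?v A) \<le> enn2ereal (?e A (E - A)) - enn2ereal (?e A (- E)))"
    unfolding sub_solution_def interaction_eq_energy vol ..
  show ?thesis
  proof (intro iffI conjI)
    assume min: "Lambda_minimal s \<Lambda> \<Omega> E"
    then have fin: "?per E < \<infinity>" unfolding minimal by blast
    have le: "?per E \<le> ?per F + ?v (sym_diff E F)"
      if "F \<in> sets lebesgue" "sym_diff E F \<subseteq> \<Omega>" for F
      using min that unfolding minimal by blast
    show "super_solution s \<Lambda> \<Omega> E"
      unfolding super
    proof (intro ballI impI)
      fix A assume A: "A \<in> sets lebesgue" "A \<subseteq> - E \<inter> \<Omega>"
      \<comment> \<open>The perturbation identities with nothing removed; the sub-solution case
        below uses them with nothing added.\<close>
      obtain X where X: "?per E = X + ?e A E" "?per (E \<union> A) = X + ?e A (- E - A)"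
        by (rule perturb[OF assms(6) \<Omega> A(1) sets.empty_sets A(2) empty_subsetI]) auto
      have "sym_diff E (E \<union> A) = A" using A by auto
      then have "X + ?e A E \<le> X + (?e A (- E - A) + ?v A)"
        using le[of "E \<union> A"] A assms(6) unfolding X by (auto simp: add.assoc)
      \<comment> \<open>Finite perimeter allows \<open>X\<close> to be cancelled and makes the
        minuend of the extended difference finite.\<close>
      moreover have "X < \<infinity>" "?e A E < \<infinity>" using fin unfolding X by auto
      ultimately show "enn2ereal (?e A E) - enn2ereal (?e A (- E - A)) \<le> enn2ereal (?v A)"
        by (intro enn2ereal_diff_leI) (auto simp: ennreal_add_left_cancel_le)
    qed
    show "sub_solution s \<Lambda> \<Omega> E"
      unfolding sub
    proof (intro ballI impI)
      fix B assume B: "B \<in> sets lebesgue" "B \<subseteq> E \<inter> \<Omega>"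
      obtain X where X: "?per E = X + ?e B (- E)" "?per (E - B) = X + ?e B (E - B)"
        by (rule perturb[OF assms(6) \<Omega> sets.empty_sets B(1) empty_subsetI B(2)]) auto
      have "sym_diff E (E - B) = B" using B by auto
      then have "X + ?e B (- E) \<le> X + (?e B (E - B) + ?v B)"
        using le[of "E - B"] B assms(6) unfolding X by (auto simp: add.assoc)
      moreover have "X < \<infinity>" "?e B (- E) < \<infinity>" using fin unfolding X by auto
      ultimately show "- enn2ereal (?v B) \<le> enn2ereal (?e B (E - B)) - enn2ereal (?e B (- E))"
        by (intro uminus_enn2ereal_le_diffI) (auto simp: ennreal_add_left_cancel_le)
    qed
  next
    assume asm: "super_solution s \<Lambda> \<Omega> E \<and> sub_solution s \<Lambda> \<Omega> E"
    have super_le: "?e A E \<le> ?e A (- E - A) + ?v A"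
      if "A \<in> sets lebesgue" "A \<subseteq> - E \<inter> \<Omega>" for A
      using asm that v_finite[of A] unfolding super by (intro enn2ereal_diff_leD) auto
    have sub_le: "?e B (- E) \<le> ?e B (E - B) + ?v B"
      if "B \<in> sets lebesgue" "B \<subseteq> E \<inter> \<Omega>" for B
      using asm that v_finite[of B] unfolding sub by (intro uminus_enn2ereal_le_diffD) auto
    have \<Omega>_fin: "?e \<Omega> (- \<Omega>) < \<infinity>"
      by (rule fractional_energy_Compl_finite) (use assms in auto)
    show "Lambda_minimal s \<Lambda> \<Omega> E"
      unfolding minimal
    proof (intro conjI ballI impI)
      \<comment> \<open>The largest admissible competitor \<open>E \<inter> \<Omega>\<close> is
        tested: what remains of \<open>E\<close> lies outside \<open>\<Omega>\<close>, so its
        interaction is controlled by that of \<open>\<Omega>\<close> with its complement.\<close>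
      have "?e (E \<inter> \<Omega>) (- E) \<le> ?e (E \<inter> \<Omega>) (E - E \<inter> \<Omega>) + ?v (E \<inter> \<Omega>)"
        using assms(6) \<Omega> by (intro sub_le) auto
      also have "\<dots> \<le> ?e \<Omega> (- \<Omega>) + ?v (E \<inter> \<Omega>)"
        by (intro add_right_mono energy_mono) auto
      also have "\<dots> < \<infinity>" using \<Omega>_fin v_finite[of "E \<inter> \<Omega>"] by simp
      finally have "?e (E \<inter> \<Omega>) (- E) < \<infinity>" .
      moreover have "?e (E \<inter> - \<Omega>) (- E \<inter> \<Omega>) \<le> ?e (- \<Omega>) \<Omega>"
        by (intro energy_mono) auto
      moreover have "?e (- \<Omega>) \<Omega> = ?e \<Omega> (- \<Omega>)"
        using \<Omega> by (intro energy_commute fractional_kernel_measurable fractional_kernel_minus)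
          (auto simp: Compl_in_sets_lebesgue)
      ultimately show "?per E < \<infinity>"
        using \<Omega>_fin unfolding energy_perimeter_def by (auto intro: le_less_trans)
    next
      fix F assume F: "F \<in> sets lebesgue" "sym_diff E F \<subseteq> \<Omega>"
      define A B where "A = F - E" and "B = E - F"
      have sets: "A \<in> sets lebesgue" "B \<in> sets lebesgue"
        using F assms(6) by (auto simp: A_def B_def)
      have sub: "A \<subseteq> - E \<inter> \<Omega>" "B \<subseteq> E \<inter> \<Omega>" and F_eq: "E \<union> A - B = F"
        and diff: "sym_diff E F = A \<union> B" "A \<inter> B = {}"
        using F by (auto simp: A_def B_def)
      obtain X where X: "?per E + ?e A B = X + ?e A E + ?e B (- E)"
        "?per F = X + ?e A (- E - A) + ?e B (E - B) + ?e A B"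
        using perturb[OF assms(6) \<Omega> sets sub] unfolding F_eq by blast
      \<comment> \<open>The cross term is harmless twice: it may be added to the perimeter of
        \<open>E\<close> here and dropped from that of \<open>F\<close> at the end.\<close>
      have "?per E \<le> ?per E + ?e A B" by simp
      also have "\<dots> \<le> X + (?e A (- E - A) + ?v A) + (?e B (E - B) + ?v B)"
        unfolding X by (intro add_mono order_refl super_le sub_le sets sub)
      also have "\<dots> = X + ?e A (- E - A) + ?e B (E - B) + ?v (sym_diff E F)"
        unfolding diff(1) plus_emeasure[OF sets diff(2), symmetric]
        by (simp add: distrib_left ac_simps)
      also have "\<dots> \<le> ?per F + ?v (sym_diff E F)"
        unfolding X by (intro add_right_mono) simp
      finally show "?per E \<le> ?per F + ?v (sym_diff E F)" .
    qed
  qed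
qed

end
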